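(* Let $r\in\mathbb C^\times$ and let $\mathcal H^\oplus$ be the braided monoidal category of $\mathbb C$-graded vector spaces of at most countable dimension with braiding $c_{U,V}=\tau_{U,V}\circ e^{\frac{\pi ir}2H_U\otimes H_V}$. Let $A\in\mathcal H^\oplus$ be any (associative unital) algebra such that 1. $A$ is commutative, 2. $A$ allows for a non-degenerate invariant pairing, 3. the graded components of $A$ have dimension $0$ or $1$. Then $A$ is isomorphic to either $\mathbb C_0$ or to $\Lambda_p$ for some $p\in\mathbb Z\setminus\{0\}$.
   Context: $H_V$ is the degree map of $V$ (acting as $\alpha$ on the degree-$\alpha$ component), $\tau$ is the flip of tensor factors, and the associator is trivial. $\mathbb C_\alpha$ denotes $\mathbb C$ placed in degree $\alpha$, with $1_\alpha$ the element $1\in\mathbb C_\alpha$; $\mathbb C_0$ is the tensor unit $\mathbf 1$ with its trivial algebra structure. Isomorphisms are isomorphisms of algebras in $\mathcal H^\oplus$. An algebra $(A,\mu,\eta)$ is commutative if $\mu\circ c_{A,A}=\mu$. A non-degenerate invariant pairing on $A$ is a morphism $\varpi:A\otimes A\to\mathbf 1$ in $\mathcal H^\oplus$ with $\varpi\circ(\mathrm{id}\otimes\mu)=\varpi\circ(\mu\otimes\mathrm{id})$ on $A\otimes A\otimes A$, and non-degenerate as a bilinear form ($\varpi(a,b)=0$ for all $a$ implies $b=0$, and vice versa). For $p\in\mathbb Z\setminus\{0\}$ set $\gamma=2\sqrt{p/r}$ (either root); $\Lambda_p=\bigoplus_{m\in\mathbb Z}\mathbb C_{m\gamma}$ with unit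 $1_0$ and product $1_{m\gamma}\otimes1_{n\gamma}\mapsto1_{(m+n)\gamma}$.
   Formalization: The algebra A is additionally assumed to be nonzero, since the zero algebra satisfies all the listed conditions but is isomorphic to neither C_0 nor any Λ_p. *)

theory Defs
  imports "HOL-Analysis.Analysis" "HOL-Library.Poly_Mapping"
begin

section \<open>Complex vector spaces\<close>

class complex_vector = ab_group_add +
  fixes scaleC :: "complex \<Rightarrow> 'a \<Rightarrow> 'a" (infixr \<open>*\<^sub>C\<close> 75)
  assumes scaleC_add_right: "c *\<^sub>C (x + y) = c *\<^sub>C x + c *\<^sub>C y"
    and scaleC_add_left: "(c + d) *\<^sub>C x = c *\<^sub>C x + d *\<^sub>C x"
    and scaleC_scaleC: "c *\<^sub>C d *\<^sub>C x = (c * d) *\<^sub>C x"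
    and scaleC_one: "1 *\<^sub>C x = x"

global_interpretation cvec: vector_space "scaleC :: complex \<Rightarrow> 'a \<Rightarrow> 'a::complex_vector"
  by unfold_locales (auto simp: scaleC_add_right scaleC_add_left scaleC_scaleC scaleC_one)

abbreviation clinear :: "('a::complex_vector \<Rightarrow> 'b::complex_vector) \<Rightarrow> bool" where
  "clinear \<equiv> Vector_Spaces.linear scaleC scaleC"

lemma clinear_iff:
  "clinear f \<longleftrightarrow> (\<forall>x y. f (x + y) = f x + f y) \<and> (\<forall>c x. f (c *\<^sub>C x) = c *\<^sub>C f x)"
  by (auto simp: Vector_Spaces.linear_def module_hom_axioms_def module_hom_def
      cvec.vector_space_axioms cvec.module_axioms)

text \<open>\<^const>\<open>cvec.dim\<close> is 0 on infinite-dimensional subspaces, hence the following predicate.\<close>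

definition has_dim :: "'a::complex_vector set \<Rightarrow> nat \<Rightarrow> bool" where
  "has_dim S n \<longleftrightarrow> (\<exists>B. finite B \<and> cvec.independent B \<and> cvec.span B = S \<and> card B = n)"

instantiation complex :: complex_vector
begin
definition scaleC_complex :: "complex \<Rightarrow> complex \<Rightarrow> complex" where
  "scaleC_complex = (*)"
instance
  by standard (auto simp: scaleC_complex_def algebra_simps)
end

instantiation poly_mapping :: (type, complex_vector) complex_vector
begin
definition scaleC_poly_mapping ::
    "complex \<Rightarrow> ('a \<Rightarrow>\<^sub>0 'b) \<Rightarrow> ('a \<Rightarrow>\<^sub>0 'b)" where
  "scaleC_poly_mapping c = Poly_Mapping.map (scaleC c)"

lemma lookup_scaleC: "Poly_Mapping.lookup (c *\<^sub>C x) k = c *\<^sub>C Poly_Mapping.lookup x k"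
  by (auto simp: scaleC_poly_mapping_def Poly_Mapping.map.rep_eq when_def)

instance
  by standard (auto intro!: poly_mapping_eqI
      simp: lookup_scaleC lookup_add scaleC_add_right scaleC_add_left scaleC_scaleC scaleC_one)
end


section \<open>Tensor products\<close>

text \<open>The tensor product is the free vector space on pairs modulo the bilinearity relations.\<close>

definition tensor_null :: "('a::complex_vector \<times> 'b::complex_vector \<Rightarrow>\<^sub>0 complex) set" where
  "tensor_null = cvec.span
    ({Poly_Mapping.single (a + a', b) 1 - Poly_Mapping.single (a, b) 1
        - Poly_Mapping.single (a', b) 1 | a a' b. True} \<union>
     {Poly_Mapping.single (a, b + b') 1 - Poly_Mapping.single (a, b) 1
        - Poly_Mapping.single (a, b') 1 | a b b'. True} \<union>
     {Poly_Mapping.single (c *\<^sub>C a, b) 1 - Poly_Mapping.single (a, b) c | c a b. True} \<union>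
     {Poly_Mapping.single (a, c *\<^sub>C b) 1 - Poly_Mapping.single (a, b) c | c a b. True})"

lemma tensor_null_simps:
  "0 \<in> tensor_null"
  "x \<in> tensor_null \<Longrightarrow> y \<in> tensor_null \<Longrightarrow> x + y \<in> tensor_null"
  "x \<in> tensor_null \<Longrightarrow> y \<in> tensor_null \<Longrightarrow> x - y \<in> tensor_null"
  "x \<in> tensor_null \<Longrightarrow> - x \<in> tensor_null"
  "x \<in> tensor_null \<Longrightarrow> c *\<^sub>C x \<in> tensor_null"
  unfolding tensor_null_def
  by (auto intro: cvec.span_zero cvec.span_add cvec.span_diff cvec.span_neg cvec.span_scale)

quotient_type (overloaded) ('a, 'b) tensor =
  "'a::complex_vector \<times> 'b::complex_vector \<Rightarrow>\<^sub>0 complex" / "\<lambda>x y. x - y \<in> tensor_null"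
proof (rule equivpI)
  show "reflp (\<lambda>x y. x - y \<in> (tensor_null :: ('a \<times> 'b \<Rightarrow>\<^sub>0 complex) set))"
    by (auto simp: reflp_def tensor_null_simps)
  show "symp (\<lambda>x y. x - y \<in> (tensor_null :: ('a \<times> 'b \<Rightarrow>\<^sub>0 complex) set))"
    by (metis (no_types, lifting) minus_diff_eq sympI tensor_null_simps(4))
  show "transp (\<lambda>x y. x - y \<in> (tensor_null :: ('a \<times> 'b \<Rightarrow>\<^sub>0 complex) set))"
  proof (rule transpI)
    fix x y z :: "'a \<times> 'b \<Rightarrow>\<^sub>0 complex"
    assume "x - y \<in> tensor_null" "y - z \<in> tensor_null"
    from tensor_null_simps(2)[OF this] show "x - z \<in> tensor_null" by simp
  qed
qed

instantiation tensor :: (complex_vector, complex_vector) complex_vector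
begin

lift_definition zero_tensor :: "('a, 'b) tensor" is 0 .

lift_definition plus_tensor :: "('a, 'b) tensor \<Rightarrow> ('a, 'b) tensor \<Rightarrow> ('a, 'b) tensor" is "(+)"
  using tensor_null_simps(2) by (fastforce simp: algebra_simps)

lift_definition minus_tensor :: "('a, 'b) tensor \<Rightarrow> ('a, 'b) tensor \<Rightarrow> ('a, 'b) tensor" is "(-)"
  using tensor_null_simps(3) by (fastforce simp: algebra_simps)

lift_definition uminus_tensor :: "('a, 'b) tensor \<Rightarrow> ('a, 'b) tensor" is "uminus"
  using tensor_null_simps(4) by (fastforce simp: algebra_simps)

lift_definition scaleC_tensor :: "complex \<Rightarrow> ('a, 'b) tensor \<Rightarrow> ('a, 'b) tensor" is "scaleC"
  using tensor_null_simps(5) by (fastforce simp: cvec.scale_right_diff_distrib)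

instance
  by standard (transfer; simp add: tensor_null_simps scaleC_add_right scaleC_add_left
      scaleC_scaleC scaleC_one algebra_simps)+

end

lift_definition pure_tensor ::
    "'a::complex_vector \<Rightarrow> 'b::complex_vector \<Rightarrow> ('a, 'b) tensor" (infixl \<open>\<otimes>\<close> 76)
  is "\<lambda>a b. Poly_Mapping.single (a, b) 1" .

lemma pure_tensor_bilinear:
  "(a + a') \<otimes> b = a \<otimes> b + a' \<otimes> b"
  "a \<otimes> (b + b') = a \<otimes> b + a \<otimes> b'"
  "(c *\<^sub>C a) \<otimes> b = c *\<^sub>C (a \<otimes> b)"
  "a \<otimes> (c *\<^sub>C b) = c *\<^sub>C (a \<otimes> b)"
proof -
  have s: "c *\<^sub>C Poly_Mapping.single p (1::complex) = Poly_Mapping.single p c" for c and p :: "'a \<times> 'b"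
    by (rule poly_mapping_eqI)
      (simp add: lookup_scaleC lookup_single scaleC_complex_def when_def)
  show "(a + a') \<otimes> b = a \<otimes> b + a' \<otimes> b"
    by (transfer, unfold tensor_null_def diff_diff_eq[symmetric], rule cvec.span_base) blast
  show "a \<otimes> (b + b') = a \<otimes> b + a \<otimes> b'"
    by (transfer, unfold tensor_null_def diff_diff_eq[symmetric], rule cvec.span_base) blast
  show "(c *\<^sub>C a) \<otimes> b = c *\<^sub>C (a \<otimes> b)"
    by (transfer, unfold tensor_null_def s, rule cvec.span_base) blast
  show "a \<otimes> (c *\<^sub>C b) = c *\<^sub>C (a \<otimes> b)"
    by (transfer, unfold tensor_null_def s, rule cvec.span_base) blast
qed

lemma pure_tensor_zero: "0 \<otimes> b = 0" "a \<otimes> 0 = 0"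
  using pure_tensor_bilinear(1)[of 0 0 b] pure_tensor_bilinear(2)[of a 0 0] by simp_all

lemma single_decomp:
  "x = (\<Sum>p\<in>Poly_Mapping.keys x.
    Poly_Mapping.lookup x p *\<^sub>C Poly_Mapping.single p (1::complex))" (is "x = ?y")
proof (rule poly_mapping_eqI)
  fix k
  have "Poly_Mapping.lookup ?y k
      = (\<Sum>p\<in>Poly_Mapping.keys x. if p = k then Poly_Mapping.lookup x p else 0)"
    unfolding lookup_sum
    by (rule sum.cong) (auto simp: lookup_scaleC lookup_single when_def scaleC_complex_def)
  also have "\<dots> = Poly_Mapping.lookup x k" by (simp add: in_keys_iff)
  finally show "Poly_Mapping.lookup x k = Poly_Mapping.lookup ?y k" ..
qed

lemma abs_tensor_surj: "\<exists>x. t = abs_tensor x"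
  by (rule exI[of _ "rep_tensor t"]) (simp add: Quotient3_abs_rep[OF Quotient3_tensor])

lemma span_pure_tensors: "cvec.span {a \<otimes> b | a b. True} = UNIV"
proof -
  have "t \<in> cvec.span {a \<otimes> b | a b. True}" for t :: "('a, 'b) tensor"
  proof -
    have cl: "clinear abs_tensor"
      by (auto simp: clinear_iff plus_tensor.abs_eq scaleC_tensor.abs_eq)
    obtain x where x: "t = abs_tensor x" using abs_tensor_surj by blast
    note h = cl[folded module_hom_iff_linear]
    have "t = abs_tensor (\<Sum>p\<in>Poly_Mapping.keys x.
        Poly_Mapping.lookup x p *\<^sub>C Poly_Mapping.single p 1)"
      unfolding x by (rule arg_cong[OF single_decomp])
    also have "\<dots> = (\<Sum>p\<in>Poly_Mapping.keys x.
        Poly_Mapping.lookup x p *\<^sub>C abs_tensor (Poly_Mapping.single p 1))"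
      by (simp only: module_hom.sum[OF h] module_hom.scale[OF h])
    also have "\<dots> = (\<Sum>p\<in>Poly_Mapping.keys x. Poly_Mapping.lookup x p *\<^sub>C (fst p \<otimes> snd p))"
      by (simp add: pure_tensor.abs_eq)
    also have "\<dots> \<in> cvec.span {a \<otimes> b | a b. True}"
      by (intro cvec.span_sum cvec.span_scale cvec.span_base) blast
    finally show ?thesis .
  qed
  then show ?thesis by auto
qed

definition bilinear_map ::
    "('a::complex_vector \<Rightarrow> 'b::complex_vector \<Rightarrow> 'c::complex_vector) \<Rightarrow> bool" where
  "bilinear_map f \<longleftrightarrow> (\<forall>a. clinear (f a)) \<and> (\<forall>b. clinear (\<lambda>a. f a b))"

text \<open>The linear map on the tensor product induced by a bilinear map.\<close>

definition tensor_lift ::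
    "('a::complex_vector \<Rightarrow> 'b::complex_vector \<Rightarrow> 'c::complex_vector)
      \<Rightarrow> ('a, 'b) tensor \<Rightarrow> 'c" where
  "tensor_lift f = (THE g. clinear g \<and> (\<forall>a b. g (a \<otimes> b) = f a b))"

lemma tensor_ext:
  fixes g h :: "('a::complex_vector, 'b::complex_vector) tensor \<Rightarrow> 'c::complex_vector"
  assumes "clinear g" "clinear h" "\<And>a b. g (a \<otimes> b) = h (a \<otimes> b)"
  shows "g = h"
proof
  fix t :: "('a, 'b) tensor"
  have "t \<in> cvec.span {a \<otimes> b | a b. True}" unfolding span_pure_tensors by (rule UNIV_I)
  then show "g t = h t"
    by (rule vector_space_pair.linear_eq_on_span[OF vector_space_pair.intro[OF
            cvec.vector_space_axioms cvec.vector_space_axioms] assms(1,2), rotated])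
      (use assms(3) in auto)
qed

lemma tensor_lift_ex:
  fixes f :: "'a::complex_vector \<Rightarrow> 'b::complex_vector \<Rightarrow> 'c::complex_vector"
  assumes "bilinear_map f"
  shows "\<exists>g. clinear g \<and> (\<forall>a b. g (a \<otimes> b) = f a b)"
proof -
  define F where "F x = (\<Sum>p\<in>Poly_Mapping.keys x. Poly_Mapping.lookup x p *\<^sub>C f (fst p) (snd p))"
    for x :: "'a \<times> 'b \<Rightarrow>\<^sub>0 complex"
  have F_on: "F x = (\<Sum>p\<in>S. Poly_Mapping.lookup x p *\<^sub>C f (fst p) (snd p))" if "finite S" "Poly_Mapping.keys x \<subseteq> S" for x S
    unfolding F_def using that by (intro sum.mono_neutral_left) (auto simp: in_keys_iff)
  have F_add: "F (x + y) = F x + F y" for x y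
    unfolding F_on[of "Poly_Mapping.keys x \<union> Poly_Mapping.keys y" x, OF _ Un_upper1, simplified]
      F_on[of "Poly_Mapping.keys x \<union> Poly_Mapping.keys y" y, OF _ Un_upper2, simplified]
      F_on[of "Poly_Mapping.keys x \<union> Poly_Mapping.keys y" "x + y", OF _ Poly_Mapping.keys_add, simplified]
    by (simp add: lookup_add scaleC_add_left sum.distrib)
  have F_scale: "F (c *\<^sub>C x) = c *\<^sub>C F x" for c x
  proof -
    have "Poly_Mapping.keys (c *\<^sub>C x) \<subseteq> Poly_Mapping.keys x"
      by (auto simp: in_keys_iff lookup_scaleC scaleC_complex_def)
    then show ?thesis
      using F_on[of "Poly_Mapping.keys x" "c *\<^sub>C x"]
      by (simp add: F_def lookup_scaleC scaleC_complex_def cvec.scale_sum_right scaleC_scaleC)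
  qed
  have F: "clinear F" by (simp add: clinear_iff F_add F_scale)
  note Fh = F[folded module_hom_iff_linear]
  have F_single: "F (Poly_Mapping.single (a, b) c) = c *\<^sub>C f a b" for a b c
    using F_on[of "{(a, b)}" "Poly_Mapping.single (a, b) c"] by simp
  have fl: "f (a + a') b = f a b + f a' b" "f a (b + b') = f a b + f a b'"
    "f (c *\<^sub>C a) b = c *\<^sub>C f a b" "f a (c *\<^sub>C b) = c *\<^sub>C f a b" for a a' b b' c
    using assms by (auto simp: bilinear_map_def clinear_iff)
  have F_null: "F x = 0" if "x \<in> tensor_null" for x
    using that unfolding tensor_null_def
    by (rule module_hom.eq_0_on_span[OF Fh, rotated])
      (auto simp: module_hom.diff[OF Fh] F_single fl scaleC_one)
  have F_cong: "F x = F y" if "x - y \<in> tensor_null" for x y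
    using F_null[OF that] by (simp add: module_hom.diff[OF Fh])
  define g where "g t = F (rep_tensor t)" for t
  have g: "g (abs_tensor x) = F x" for x
    unfolding g_def
    by (rule F_cong, rule rep_abs_rsp_left[OF Quotient3_tensor]) (simp add: tensor_null_simps)
  have "clinear g"
    unfolding clinear_iff
  proof (intro conjI allI)
    fix s t :: "('a, 'b) tensor" and c
    obtain x y where "s = abs_tensor x" "t = abs_tensor y"
      using abs_tensor_surj by blast
    then show "g (s + t) = g s + g t" "g (c *\<^sub>C s) = c *\<^sub>C g s"
      by (simp_all add: g plus_tensor.abs_eq scaleC_tensor.abs_eq F_add F_scale)
  qed
  moreover have "g (a \<otimes> b) = f a b" for a b
    by (simp add: pure_tensor.abs_eq g F_single scaleC_one)
  ultimately show ?thesis by blast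
qed

lemma tensor_lift:
  assumes "bilinear_map f"
  shows "clinear (tensor_lift f)" and "tensor_lift f (a \<otimes> b) = f a b"
proof -
  have "\<exists>!g. clinear g \<and> (\<forall>a b. g (a \<otimes> b) = f a b)"
    using tensor_lift_ex[OF assms] by (auto intro: tensor_ext)
  from theI'[OF this, folded tensor_lift_def]
  show "clinear (tensor_lift f)" and "tensor_lift f (a \<otimes> b) = f a b" by auto
qed

definition tensor_map ::
    "('a::complex_vector \<Rightarrow> 'c::complex_vector) \<Rightarrow> ('b::complex_vector \<Rightarrow> 'd::complex_vector)
      \<Rightarrow> ('a, 'b) tensor \<Rightarrow> ('c, 'd) tensor" where
  "tensor_map f g = tensor_lift (\<lambda>a b. f a \<otimes> g b)"

definition flip :: "('a::complex_vector, 'b::complex_vector) tensor \<Rightarrow> ('b, 'a) tensor" where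
  "flip = tensor_lift (\<lambda>a b. b \<otimes> a)"

definition associator ::
    "(('a::complex_vector, 'b::complex_vector) tensor, 'c::complex_vector) tensor
      \<Rightarrow> ('a, ('b, 'c) tensor) tensor" where
  "associator = tensor_lift (\<lambda>t c. tensor_lift (\<lambda>a b. a \<otimes> (b \<otimes> c)) t)"

definition left_unitor :: "(complex, 'a::complex_vector) tensor \<Rightarrow> 'a" where
  "left_unitor = tensor_lift (\<lambda>z a. z *\<^sub>C a)"

definition right_unitor :: "('a::complex_vector, complex) tensor \<Rightarrow> 'a" where
  "right_unitor = tensor_lift (\<lambda>a z. z *\<^sub>C a)"

lemma bilinear_map_tensor_map: "clinear f \<Longrightarrow> clinear g \<Longrightarrow> bilinear_map (\<lambda>a b. f a \<otimes> g b)"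
  by (auto simp: bilinear_map_def clinear_iff pure_tensor_bilinear)

lemma tensor_map:
  assumes "clinear f" "clinear g"
  shows "clinear (tensor_map f g)" and "tensor_map f g (a \<otimes> b) = f a \<otimes> g b"
  unfolding tensor_map_def using bilinear_map_tensor_map[OF assms] by (auto intro: tensor_lift)

lemma flip: "clinear flip" "flip (a \<otimes> b) = b \<otimes> a"
proof -
  have "bilinear_map (\<lambda>a b. b \<otimes> a)"
    by (auto simp: bilinear_map_def clinear_iff pure_tensor_bilinear)
  then show "clinear flip" "flip (a \<otimes> b) = b \<otimes> a"
    unfolding flip_def by (auto intro: tensor_lift)
qed

lemma associator:
  fixes a :: "'a::complex_vector" and b :: "'b::complex_vector" and c :: "'c::complex_vector"
  shows "clinear (associator :: (('a, 'b) tensor, 'c) tensor \<Rightarrow> _)"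
    and "associator ((a \<otimes> b) \<otimes> c) = a \<otimes> (b \<otimes> c)"
proof -
  define H :: "('a, 'b) tensor \<Rightarrow> 'c \<Rightarrow> ('a, ('b, 'c) tensor) tensor"
    where "H t c = tensor_lift (\<lambda>a b. a \<otimes> (b \<otimes> c)) t" for t c
  have bil: "bilinear_map (\<lambda>(a::'a) (b::'b). a \<otimes> (b \<otimes> c))" for c :: 'c
    by (auto simp: bilinear_map_def clinear_iff pure_tensor_bilinear)
  have lin: "clinear (\<lambda>t. H t c)" for c
    unfolding H_def by (rule tensor_lift(1)[OF bil])
  have pure: "H (a \<otimes> b) c = a \<otimes> (b \<otimes> c)" for a b c
    unfolding H_def by (rule tensor_lift(2)[OF bil])
  have "(\<lambda>t. H t (c + d)) = (\<lambda>t. H t c + H t d)" for c d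
    using lin by (intro tensor_ext) (auto simp: pure pure_tensor_bilinear clinear_iff scaleC_add_right)
  moreover have "(\<lambda>t. H t (z *\<^sub>C c)) = (\<lambda>t. z *\<^sub>C H t c)" for z c
    using lin by (intro tensor_ext) (auto simp: pure pure_tensor_bilinear clinear_iff
        scaleC_add_right scaleC_scaleC mult.commute)
  ultimately have H: "bilinear_map H"
    using lin by (auto simp: bilinear_map_def fun_eq_iff clinear_iff)
  have eq: "associator = tensor_lift H"
    unfolding associator_def by (simp add: H_def[abs_def])
  show "clinear (associator :: (('a, 'b) tensor, 'c) tensor \<Rightarrow> _)"
    unfolding eq by (rule tensor_lift(1)[OF H])
  show "associator ((a \<otimes> b) \<otimes> c) = a \<otimes> (b \<otimes> c)"
    unfolding eq tensor_lift(2)[OF H] pure ..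
qed

lemma left_unitor:
  fixes a :: "'a::complex_vector"
  shows "clinear (left_unitor :: _ \<Rightarrow> 'a)" "left_unitor (z \<otimes> a) = z *\<^sub>C a"
proof -
  have "bilinear_map (\<lambda>z::complex. \<lambda>a::'a. z *\<^sub>C a)"
    by (auto simp: bilinear_map_def clinear_iff scaleC_add_right scaleC_add_left scaleC_scaleC
        scaleC_complex_def mult.commute)
  then show "clinear (left_unitor :: _ \<Rightarrow> 'a)" "left_unitor (z \<otimes> a) = z *\<^sub>C a"
    unfolding left_unitor_def by (simp_all add: tensor_lift)
qed

lemma right_unitor:
  fixes a :: "'a::complex_vector"
  shows "clinear (right_unitor :: _ \<Rightarrow> 'a)" "right_unitor (a \<otimes> z) = z *\<^sub>C a"
proof -
  have "bilinear_map (\<lambda>a::'a. \<lambda>z::complex. z *\<^sub>C a)"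
    by (auto simp: bilinear_map_def clinear_iff scaleC_add_right scaleC_add_left scaleC_scaleC
        scaleC_complex_def mult.commute)
  then show "clinear (right_unitor :: _ \<Rightarrow> 'a)" "right_unitor (a \<otimes> z) = z *\<^sub>C a"
    unfolding right_unitor_def by (simp_all add: tensor_lift)
qed


section \<open>The braided monoidal category of graded vector spaces\<close>

text \<open>A grading of a vector space by the complex numbers is the family of its homogeneous
  components. An object of the category is a type of class \<^class>\<open>complex_vector\<close>
  together with a grading satisfying \<open>graded_space\<close> below.\<close>

type_synonym 'a grading = "complex \<Rightarrow> 'a set"

definition is_decomp :: "'a::complex_vector grading \<Rightarrow> 'a \<Rightarrow> (complex \<Rightarrow> 'a) \<Rightarrow> bool" where
  "is_decomp V v f \<longleftrightarrow>
    finite {\<alpha>. f \<alpha> \<noteq> 0} \<and> (\<forall>\<alpha>. f \<alpha> \<in> V \<alpha>) \<and> v = (\<Sum>\<alpha> | f \<alpha> \<noteq> 0. f \<alpha>)"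

definition component :: "'a::complex_vector grading \<Rightarrow> complex \<Rightarrow> 'a \<Rightarrow> 'a" where
  "component V \<alpha> v = (THE f. is_decomp V v f) \<alpha>"

definition graded_space :: "'a::complex_vector grading \<Rightarrow> bool" where
  "graded_space V \<longleftrightarrow>
    (\<forall>\<alpha>. cvec.subspace (V \<alpha>)) \<and>
    (\<forall>v. \<exists>!f. is_decomp V v f) \<and>
    (\<exists>B::'a set. countable B \<and> cvec.span B = UNIV)"

definition hom ::
    "'a::complex_vector grading \<Rightarrow> 'b::complex_vector grading \<Rightarrow> ('a \<Rightarrow> 'b) set" where
  "hom V W = {f. clinear f \<and> (\<forall>\<alpha>. \<forall>v\<in>V \<alpha>. f v \<in> W \<alpha>)}"

definition tensor_grading ::
    "'a::complex_vector grading \<Rightarrow> 'b::complex_vector grading \<Rightarrow> ('a, 'b) tensor grading" where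
  "tensor_grading V W \<gamma> = cvec.span {v \<otimes> w | v w \<alpha> \<beta>. v \<in> V \<alpha> \<and> w \<in> W \<beta> \<and> \<alpha> + \<beta> = \<gamma>}"

definition unit_grading :: "complex grading" where
  "unit_grading \<alpha> = (if \<alpha> = 0 then UNIV else {0})"

text \<open>The map \<open>exp (q H\<^sub>V \<otimes> H\<^sub>W)\<close>: since the degree maps \<open>H\<^sub>V\<close> and \<open>H\<^sub>W\<close> act as \<open>\<alpha>\<close> on
  \<open>V \<alpha>\<close> and as \<open>\<beta>\<close> on \<open>W \<beta>\<close>, it acts as \<open>exp (q \<alpha> \<beta>)\<close> on the tensor product of \<open>V \<alpha>\<close>
  and \<open>W \<beta>\<close>.\<close>

definition exp_HH ::
    "complex \<Rightarrow> 'a::complex_vector grading \<Rightarrow> 'b::complex_vector grading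
      \<Rightarrow> ('a, 'b) tensor \<Rightarrow> ('a, 'b) tensor" where
  "exp_HH q V W = tensor_lift (\<lambda>v w.
    \<Sum>\<alpha> | component V \<alpha> v \<noteq> 0. \<Sum>\<beta> | component W \<beta> w \<noteq> 0.
      exp (q * \<alpha> * \<beta>) *\<^sub>C (component V \<alpha> v \<otimes> component W \<beta> w))"

definition braiding ::
    "complex \<Rightarrow> 'a::complex_vector grading \<Rightarrow> 'b::complex_vector grading
      \<Rightarrow> ('a, 'b) tensor \<Rightarrow> ('b, 'a) tensor" where
  "braiding r V W = flip \<circ> exp_HH (of_real pi * \<i> * r / 2) V W"

lemma component_eqI:
  assumes "graded_space V" "is_decomp V v f"
  shows "component V \<alpha> v = f \<alpha>"
proof -
  have "(THE f. is_decomp V v f) = f"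
    by (rule the1_equality) (use assms in \<open>auto simp: graded_space_def\<close>)
  then show ?thesis by (simp add: component_def)
qed

lemma is_decomp_component:
  assumes "graded_space V"
  shows "is_decomp V v (\<lambda>\<alpha>. component V \<alpha> v)"
  using theI'[of "is_decomp V v"] assms unfolding graded_space_def component_def by auto

lemma component_homogeneous:
  assumes "graded_space V" "v \<in> V \<alpha>"
  shows "component V \<beta> v = (if \<beta> = \<alpha> then v else 0)"
proof (rule component_eqI[OF assms(1)])
  have "{\<beta>. (if \<beta> = \<alpha> then v else 0) \<noteq> 0} = (if v = 0 then {} else {\<alpha>})" by auto
  then show "is_decomp V v (\<lambda>\<beta>. if \<beta> = \<alpha> then v else 0)"
    using assms by (auto simp: is_decomp_def graded_space_def cvec.subspace_0)
qed

lemma clinear_component: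
  assumes "graded_space V"
  shows "clinear (component V \<alpha>)"
  unfolding clinear_iff
proof (intro conjI allI)
  note sub = assms[unfolded graded_space_def, THEN conjunct1, rule_format]
  fix x y :: 'a and c
  let ?x = "\<lambda>\<alpha>. component V \<alpha> x" and ?y = "\<lambda>\<alpha>. component V \<alpha> y"
  have dx: "is_decomp V x ?x" and dy: "is_decomp V y ?y"
    using is_decomp_component[OF assms] by auto
  let ?S = "{\<alpha>. ?x \<alpha> \<noteq> 0} \<union> {\<alpha>. ?y \<alpha> \<noteq> 0}"
  have fin: "finite ?S" using dx dy by (auto simp: is_decomp_def)
  have "sum ?x {\<alpha>. ?x \<alpha> \<noteq> 0} = sum ?x ?S" "sum ?y {\<alpha>. ?y \<alpha> \<noteq> 0} = sum ?y ?S"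
    by (rule sum.mono_neutral_left; use fin in auto)+
  then have X: "x = sum ?x ?S" and Y: "y = sum ?y ?S"
    using dx dy unfolding is_decomp_def by (blast intro: trans)+
  have "is_decomp V (x + y) (\<lambda>\<alpha>. ?x \<alpha> + ?y \<alpha>)"
    unfolding is_decomp_def
  proof (intro conjI allI)
    have sub': "{\<alpha>. ?x \<alpha> + ?y \<alpha> \<noteq> 0} \<subseteq> ?S" by auto
    then show "finite {\<alpha>. ?x \<alpha> + ?y \<alpha> \<noteq> 0}" using fin finite_subset by blast
    show "?x \<alpha> + ?y \<alpha> \<in> V \<alpha>" for \<alpha>
      using dx dy sub by (auto simp: is_decomp_def cvec.subspace_add)
    have "x + y = (\<Sum>\<alpha>\<in>?S. ?x \<alpha> + ?y \<alpha>)"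
      unfolding sum.distrib by (rule arg_cong2[OF X Y])
    also have "\<dots> = (\<Sum>\<alpha> | ?x \<alpha> + ?y \<alpha> \<noteq> 0. ?x \<alpha> + ?y \<alpha>)"
      using fin sub' by (intro sum.mono_neutral_right) auto
    finally show "x + y = (\<Sum>\<alpha> | ?x \<alpha> + ?y \<alpha> \<noteq> 0. ?x \<alpha> + ?y \<alpha>)" .
  qed
  then show "component V \<alpha> (x + y) = component V \<alpha> x + component V \<alpha> y"
    by (rule component_eqI[OF assms])
  let ?T = "{\<alpha>. ?x \<alpha> \<noteq> 0}"
  have "is_decomp V (c *\<^sub>C x) (\<lambda>\<alpha>. c *\<^sub>C ?x \<alpha>)"
    unfolding is_decomp_def
  proof (intro conjI allI)
    have finT: "finite ?T" using dx by (auto simp: is_decomp_def)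
    then show "finite {\<alpha>. c *\<^sub>C ?x \<alpha> \<noteq> 0}" by (rule rev_finite_subset) auto
    show "c *\<^sub>C ?x \<alpha> \<in> V \<alpha>" for \<alpha>
      using dx sub by (auto simp: is_decomp_def cvec.subspace_scale)
    have "c *\<^sub>C x = (\<Sum>\<alpha>\<in>?T. c *\<^sub>C ?x \<alpha>)"
      using dx unfolding is_decomp_def cvec.scale_sum_right[symmetric]
      by (intro arg_cong[where f = "scaleC c"]) blast
    also have "\<dots> = (\<Sum>\<alpha> | c *\<^sub>C ?x \<alpha> \<noteq> 0. c *\<^sub>C ?x \<alpha>)"
      using finT by (intro sum.mono_neutral_right) auto
    finally show "c *\<^sub>C x = (\<Sum>\<alpha> | c *\<^sub>C ?x \<alpha> \<noteq> 0. c *\<^sub>C ?x \<alpha>)" .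
  qed
  then show "component V \<alpha> (c *\<^sub>C x) = c *\<^sub>C component V \<alpha> x"
    by (rule component_eqI[OF assms])
qed

lemma exp_HH:
  fixes V :: "'a::complex_vector grading" and W :: "'b::complex_vector grading"
  assumes V: "graded_space V" and W: "graded_space W"
  shows "clinear (exp_HH q V W)"
    and "v \<in> V \<alpha> \<Longrightarrow> w \<in> W \<beta> \<Longrightarrow> exp_HH q V W (v \<otimes> w) = exp (q * \<alpha> * \<beta>) *\<^sub>C (v \<otimes> w)"
proof -
  define f where "f v w = (\<Sum>\<alpha> | component V \<alpha> v \<noteq> 0. \<Sum>\<beta> | component W \<beta> w \<noteq> 0.
      exp (q * \<alpha> * \<beta>) *\<^sub>C (component V \<alpha> v \<otimes> component W \<beta> w))" for v w
  have finV: "finite {\<alpha>. component V \<alpha> v \<noteq> 0}" for v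
    using is_decomp_component[OF V, of v] by (auto simp: is_decomp_def)
  have finW: "finite {\<beta>. component W \<beta> w \<noteq> 0}" for w
    using is_decomp_component[OF W, of w] by (auto simp: is_decomp_def)
  have f: "f v w = (\<Sum>\<alpha>\<in>S. \<Sum>\<beta>\<in>T. exp (q * \<alpha> * \<beta>) *\<^sub>C (component V \<alpha> v \<otimes> component W \<beta> w))"
    if "finite S" "finite T" "{\<alpha>. component V \<alpha> v \<noteq> 0} \<subseteq> S" "{\<beta>. component W \<beta> w \<noteq> 0} \<subseteq> T"
    for v w S T
  proof -
    have "f v w = (\<Sum>\<alpha> | component V \<alpha> v \<noteq> 0. \<Sum>\<beta>\<in>T.
        exp (q * \<alpha> * \<beta>) *\<^sub>C (component V \<alpha> v \<otimes> component W \<beta> w))"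
      unfolding f_def
      by (intro sum.cong refl sum.mono_neutral_left) (use that in \<open>auto simp: pure_tensor_zero\<close>)
    also have "\<dots> = (\<Sum>\<alpha>\<in>S. \<Sum>\<beta>\<in>T.
        exp (q * \<alpha> * \<beta>) *\<^sub>C (component V \<alpha> v \<otimes> component W \<beta> w))"
      by (intro sum.mono_neutral_left) (use that in \<open>auto simp: pure_tensor_zero\<close>)
    finally show ?thesis .
  qed
  have add: "component V \<alpha> (x + y) = component V \<alpha> x + component V \<alpha> y"
    "component V \<alpha> (c *\<^sub>C x) = c *\<^sub>C component V \<alpha> x" for \<alpha> x y c
    using clinear_component[OF V] by (auto simp: clinear_iff)
  have add': "component W \<alpha> (x + y) = component W \<alpha> x + component W \<alpha> y"
    "component W \<alpha> (c *\<^sub>C x) = c *\<^sub>C component W \<alpha> x" for \<alpha> x y c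
    using clinear_component[OF W] by (auto simp: clinear_iff)
  have bil: "bilinear_map f"
    unfolding bilinear_map_def clinear_iff
  proof (intro conjI allI)
    fix v x y and c
    let ?S = "{\<alpha>. component V \<alpha> v \<noteq> 0}"
    let ?T = "{\<alpha>. component W \<alpha> x \<noteq> 0} \<union> {\<alpha>. component W \<alpha> y \<noteq> 0}"
    have S: "finite ?S" and T: "finite ?T" using finV finW by auto
    have T': "{\<alpha>. component W \<alpha> x \<noteq> 0} \<subseteq> ?T" "{\<alpha>. component W \<alpha> y \<noteq> 0} \<subseteq> ?T"
      "{\<alpha>. component W \<alpha> (x + y) \<noteq> 0} \<subseteq> ?T" "{\<alpha>. component W \<alpha> (c *\<^sub>C x) \<noteq> 0} \<subseteq> ?T"
      by (auto simp: add')
    note f' = T'[THEN f[OF S T order.refl]]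
    show "f v (x + y) = f v x + f v y"
      unfolding f' by (simp add: add' pure_tensor_bilinear scaleC_add_right sum.distrib)
    show "f v (c *\<^sub>C x) = c *\<^sub>C f v x"
      unfolding f'
      by (simp add: add' pure_tensor_bilinear cvec.scale_sum_right scaleC_scaleC mult.commute)
  next
    fix w x y and c
    let ?T = "{\<alpha>. component W \<alpha> w \<noteq> 0}"
    let ?S = "{\<alpha>. component V \<alpha> x \<noteq> 0} \<union> {\<alpha>. component V \<alpha> y \<noteq> 0}"
    have S: "finite ?S" and T: "finite ?T" using finV finW by auto
    have S': "{\<alpha>. component V \<alpha> x \<noteq> 0} \<subseteq> ?S" "{\<alpha>. component V \<alpha> y \<noteq> 0} \<subseteq> ?S"
      "{\<alpha>. component V \<alpha> (x + y) \<noteq> 0} \<subseteq> ?S" "{\<alpha>. component V \<alpha> (c *\<^sub>C x) \<noteq> 0} \<subseteq> ?S"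
      by (auto simp: add)
    note f' = S'[THEN f[OF S T _ order.refl]]
    show "f (x + y) w = f x w + f y w"
      unfolding f' by (simp add: add pure_tensor_bilinear scaleC_add_right sum.distrib)
    show "f (c *\<^sub>C x) w = c *\<^sub>C f x w"
      unfolding f'
      by (simp add: add pure_tensor_bilinear cvec.scale_sum_right scaleC_scaleC mult.commute)
  qed
  have eq: "exp_HH q V W = tensor_lift f"
    by (simp add: exp_HH_def f_def[abs_def])
  show "clinear (exp_HH q V W)" using tensor_lift(1)[OF bil] by (simp add: eq)
  assume v: "v \<in> V \<alpha>" and w: "w \<in> W \<beta>"
  have "exp_HH q V W (v \<otimes> w) = f v w" using tensor_lift(2)[OF bil] by (simp add: eq)
  also have "\<dots> = exp (q * \<alpha> * \<beta>) *\<^sub>C (v \<otimes> w)"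
    by (subst f[of "{\<alpha>}" "{\<beta>}"])
      (auto simp: component_homogeneous[OF V v] component_homogeneous[OF W w])
  finally show "exp_HH q V W (v \<otimes> w) = exp (q * \<alpha> * \<beta>) *\<^sub>C (v \<otimes> w)" .
qed

lemma braiding_homogeneous:
  assumes "graded_space V" "graded_space W" "v \<in> V \<alpha>" "w \<in> W \<beta>"
  shows "braiding r V W (v \<otimes> w) = exp (of_real pi * \<i> * r / 2 * \<alpha> * \<beta>) *\<^sub>C (w \<otimes> v)"
  by (simp add: braiding_def exp_HH(2)[OF assms] flip(2)
      flip(1)[unfolded clinear_iff, THEN conjunct2, rule_format])


section \<open>Algebras\<close>

record (overloaded) 'a graded_algebra =
  grade :: "'a grading"
  mult :: "('a::complex_vector, 'a) tensor \<Rightarrow> 'a"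
  unit_map :: "complex \<Rightarrow> 'a"

definition algebra :: "'a::complex_vector graded_algebra \<Rightarrow> bool" where
  "algebra A \<longleftrightarrow>
    graded_space (grade A) \<and>
    mult A \<in> hom (tensor_grading (grade A) (grade A)) (grade A) \<and>
    unit_map A \<in> hom unit_grading (grade A) \<and>
    mult A \<circ> tensor_map (mult A) id = mult A \<circ> tensor_map id (mult A) \<circ> associator \<and>
    mult A \<circ> tensor_map (unit_map A) id = left_unitor \<and>
    mult A \<circ> tensor_map id (unit_map A) = right_unitor"

definition commutative :: "complex \<Rightarrow> 'a::complex_vector graded_algebra \<Rightarrow> bool" where
  "commutative r A \<longleftrightarrow> mult A \<circ> braiding r (grade A) (grade A) = mult A"

definition invariant_pairing ::
    "'a::complex_vector graded_algebra \<Rightarrow> (('a, 'a) tensor \<Rightarrow> complex) \<Rightarrow> bool" where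
  "invariant_pairing A \<omega> \<longleftrightarrow>
    \<omega> \<in> hom (tensor_grading (grade A) (grade A)) unit_grading \<and>
    \<omega> \<circ> tensor_map id (mult A) \<circ> associator = \<omega> \<circ> tensor_map (mult A) id"

definition nondegenerate :: "(('a::complex_vector, 'a) tensor \<Rightarrow> complex) \<Rightarrow> bool" where
  "nondegenerate \<omega> \<longleftrightarrow>
    (\<forall>b. (\<forall>a. \<omega> (a \<otimes> b) = 0) \<longrightarrow> b = 0) \<and>
    (\<forall>a. (\<forall>b. \<omega> (a \<otimes> b) = 0) \<longrightarrow> a = 0)"

definition algebra_hom ::
    "'a::complex_vector graded_algebra \<Rightarrow> 'b::complex_vector graded_algebra \<Rightarrow> ('a \<Rightarrow> 'b) set" where
  "algebra_hom A B = {f \<in> hom (grade A) (grade B).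
    f \<circ> mult A = mult B \<circ> tensor_map f f \<and> f \<circ> unit_map A = unit_map B}"

definition algebra_iso ::
    "'a::complex_vector graded_algebra \<Rightarrow> 'b::complex_vector graded_algebra \<Rightarrow> bool" (infix \<open>\<cong>\<close> 50)
  where "A \<cong> B \<longleftrightarrow> (\<exists>f\<in>algebra_hom A B. \<exists>g\<in>algebra_hom B A. g \<circ> f = id \<and> f \<circ> g = id)"

definition unit_algebra :: "complex graded_algebra" where
  "unit_algebra = \<lparr>grade = unit_grading, mult = left_unitor, unit_map = id\<rparr>"

text \<open>The algebra \<open>\<Lambda>\<^sub>p\<close> is \<open>lattice_algebra \<gamma>\<close> with \<open>\<gamma> = 2 * s\<close>, \<open>s\<^sup>2 = p / r\<close>. The basis vector of
  degree \<open>m \<gamma>\<close> is \<^term>\<open>Poly_Mapping.single (m::int) (1::complex)\<close>; multiplication on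
  \<^typ>\<open>int \<Rightarrow>\<^sub>0 complex\<close> is convolution, see \<open>lattice_mult\<close> below. This is a graded space only
  for \<open>\<gamma> \<noteq> 0\<close>.\<close>

definition lattice_algebra :: "complex \<Rightarrow> (int \<Rightarrow>\<^sub>0 complex) graded_algebra" where
  "lattice_algebra \<gamma> = \<lparr>
    grade = (\<lambda>\<alpha>. {x. \<forall>m. Poly_Mapping.lookup x m \<noteq> 0 \<longrightarrow> of_int m * \<gamma> = \<alpha>}),
    mult = tensor_lift (*),
    unit_map = Poly_Mapping.single 0\<rparr>"

lemma scaleC_eq_single_mult: "c *\<^sub>C x = Poly_Mapping.single 0 c * (x :: int \<Rightarrow>\<^sub>0 complex)"
  by (rule poly_mapping_eqI)
    (simp add: scaleC_poly_mapping_def scaleC_complex_def Poly_Mapping.mult_map_scale_conv_mult)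

lemma bilinear_lattice_mult: "bilinear_map ((*) :: (int \<Rightarrow>\<^sub>0 complex) \<Rightarrow> _)"
  by (auto simp: bilinear_map_def clinear_iff scaleC_eq_single_mult algebra_simps)

lemma lattice_mult:
  "mult (lattice_algebra \<gamma>) (Poly_Mapping.single m 1 \<otimes> Poly_Mapping.single n 1)
    = Poly_Mapping.single (m + n) 1"
  by (simp add: lattice_algebra_def tensor_lift(2)[OF bilinear_lattice_mult] mult_single)

end

theory Submission
  imports Defs
begin

text \<open>Non-degeneracy and invariance of the pairing make every nonzero homogeneous element
  invertible, so the set \<open>G\<close> of degrees of \<open>A\<close> is a subgroup of the complex numbers and \<open>A\<close> is
  spanned by invertible elements, one in each degree of \<open>G\<close>. Commutativity applied to the
  (nonzero) square of an element of degree \<open>\<alpha>\<close> gives \<open>r * \<alpha>\<^sup>2 / 4 \<in> \<int>\<close>. An additive group of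
  complex numbers on which a quadratic form \<open>c * \<alpha>\<^sup>2\<close> is integer-valued is cyclic, by division
  with remainder. If \<open>\<gamma>\<close> generates \<open>G\<close> and \<open>x\<close> spans the component of degree \<open>\<gamma>\<close>, then the powers
  of \<open>x\<close> identify \<open>A\<close> with the lattice algebra.\<close>

section \<open>Additive groups of complex numbers with an integer-valued quadratic form\<close>

text \<open>Polarisation makes every element of \<open>G\<close> a rational multiple of any fixed
  nonzero one, so Euclidean descent applies although \<open>G\<close> lies in the plane. The size
  function is the absolute value of the form, and a nonzero element of least size is a
  generator.\<close>

lemma additive_group_integral_form_cyclic:
  fixes G :: "complex set" and c :: complex
  assumes c: "c \<noteq> 0"
    and diff: "\<And>\<alpha> \<beta>. \<alpha> \<in> G \<Longrightarrow> \<beta> \<in> G \<Longrightarrow> \<alpha> - \<beta> \<in> G"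
    and int: "\<And>\<alpha>. \<alpha> \<in> G \<Longrightarrow> c * \<alpha>\<^sup>2 \<in> \<int>"
    and nontrivial: "\<exists>\<alpha>\<in>G. \<alpha> \<noteq> 0"
  obtains \<gamma> where "\<gamma> \<noteq> 0" "\<gamma> \<in> G" "\<And>\<beta>. \<beta> \<in> G \<Longrightarrow> \<exists>m. \<beta> = of_int m * \<gamma>"
proof -
  have zero: "0 \<in> G" using nontrivial diff by (metis diff_self)
  have add: "\<alpha> + \<beta> \<in> G" if "\<alpha> \<in> G" "\<beta> \<in> G" for \<alpha> \<beta>
    using diff[OF that(1) diff[OF zero that(2)]] by simp
  have scale_nat: "of_nat n * \<alpha> \<in> G" if "\<alpha> \<in> G" for n \<alpha>
    by (induction n) (auto simp: zero algebra_simps intro: add that)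
  have scale: "of_int m * \<alpha> \<in> G" if "\<alpha> \<in> G" for m \<alpha>
    using scale_nat[OF that, of "nat m"] diff[OF zero scale_nat[OF that, of "nat (- m)"]]
    by (cases "m \<ge> 0") auto
  \<comment> \<open>On \<open>G\<close> the form takes integer values, so the floor changes nothing
    there and sizes become natural numbers, among which a minimum exists.\<close>
  define N where "N \<alpha> = nat \<lfloor>cmod (c * \<alpha>\<^sup>2)\<rfloor>" for \<alpha>
  have N: "real (N \<alpha>) = cmod (c * \<alpha>\<^sup>2)" if "\<alpha> \<in> G" for \<alpha>
    using int[OF that] unfolding N_def by (elim Ints_cases) simp
  obtain \<gamma> where \<gamma>: "\<gamma> \<in> G" "\<gamma> \<noteq> 0"
    and least: "\<And>\<beta>. \<beta> \<in> G \<Longrightarrow> \<beta> \<noteq> 0 \<Longrightarrow> N \<gamma> \<le> N \<beta>"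
    using nontrivial ex_has_least_nat[of "\<lambda>\<alpha>. \<alpha> \<in> G \<and> \<alpha> \<noteq> 0" _ N] by blast
  obtain n where n: "c * \<gamma>\<^sup>2 = of_int n" using int[OF \<gamma>(1)] by (elim Ints_cases)
  have "n \<noteq> 0" using n c \<gamma>(2) by auto
  have "\<exists>m. \<beta> = of_int m * \<gamma>" if \<beta>: "\<beta> \<in> G" for \<beta>
  proof -
    \<comment> \<open>The polar form is integral. Dividing it by twice the nonzero integer
      \<open>c * \<gamma>\<^sup>2\<close> gives the rational ratio \<open>t\<close> of \<beta> to
      \<gamma>.\<close>
    have "c * (\<beta> + \<gamma>)\<^sup>2 - c * \<beta>\<^sup>2 - c * \<gamma>\<^sup>2 \<in> \<int>"
      by (intro Ints_diff int add \<beta> \<gamma>)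
    then have "2 * c * \<beta> * \<gamma> \<in> \<int>" by (simp add: power2_eq_square algebra_simps)
    then obtain k where k: "2 * c * \<beta> * \<gamma> = of_int k" by (elim Ints_cases)
    define t :: real where "t = of_int k / (2 * of_int n)"
    have "\<beta> = of_real t * \<gamma>"
    proof -
      have "of_int k * \<gamma> = 2 * \<beta> * of_int n"
        unfolding k[symmetric] n[symmetric] by (simp add: power2_eq_square)
      then show ?thesis using \<open>n \<noteq> 0\<close> unfolding t_def by (simp add: field_simps)
    qed
    \<comment> \<open>The remainder of \<beta> modulo \<gamma>, with the quotient rounded to the
      nearest integer. It is at most half as long as \<gamma>, so its size is strictly smaller and
      minimality forces it to vanish.\<close>
    define \<delta> where "\<delta> = \<beta> - of_int (round t) * \<gamma>"
    have \<delta>: "\<delta> = of_real (t - of_int (round t)) * \<gamma>"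
      unfolding \<delta>_def \<open>\<beta> = of_real t * \<gamma>\<close> by (simp add: algebra_simps)
    have \<delta>G: "\<delta> \<in> G" unfolding \<delta>_def by (intro diff \<beta> scale \<gamma>)
    have "\<bar>t - of_int (round t)\<bar> \<le> 1 / 2"
      using of_int_round_abs_le[of t] by (simp add: abs_minus_commute)
    then have "(t - of_int (round t))\<^sup>2 \<le> (1 / 2)\<^sup>2"
      using power_mono[of "\<bar>t - of_int (round t)\<bar>" "1 / 2" 2] by simp
    then have "(t - of_int (round t))\<^sup>2 < 1" by (simp add: power2_eq_square)
    then have "(t - of_int (round t))\<^sup>2 * cmod (c * \<gamma>\<^sup>2) < 1 * cmod (c * \<gamma>\<^sup>2)"
      using c \<gamma>(2) by (intro mult_strict_right_mono) auto
    moreover have "cmod (c * \<delta>\<^sup>2) = (t - of_int (round t))\<^sup>2 * cmod (c * \<gamma>\<^sup>2)"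
      unfolding \<delta> norm_mult norm_power norm_of_real power_mult_distrib by simp
    ultimately have "real (N \<delta>) < real (N \<gamma>)" unfolding N[OF \<delta>G] N[OF \<gamma>(1)] by simp
    then have "\<delta> = 0" using least[OF \<delta>G] by force
    then show ?thesis unfolding \<delta>_def by auto
  qed
  then show ?thesis using that \<gamma> by blast
qed

section \<open>Finitely supported functions, one-dimensional spaces and bijective
  homomorphisms\<close>

text \<open>Finitely supported functions are finite sums of one-point functions. The zero function
  is a one-point function with coefficient 0, hence there is no separate base case.\<close>

lemma poly_mapping_single_add_induct [case_names single add]:
  fixes x :: "'k \<Rightarrow>\<^sub>0 complex"
  assumes single: "\<And>k c. P (Poly_Mapping.single k c)"
    and add: "\<And>x y. P x \<Longrightarrow> P y \<Longrightarrow> P (x + y)"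
  shows "P x"
proof -
  have "P (c *\<^sub>C Poly_Mapping.single k 1)" for c k
  proof -
    have "c *\<^sub>C Poly_Mapping.single k 1 = Poly_Mapping.single k c"
      by (rule poly_mapping_eqI)
        (simp add: lookup_scaleC lookup_single scaleC_complex_def when_def)
    then show ?thesis by (simp add: single)
  qed
  then have "P (\<Sum>k\<in>S. f k *\<^sub>C Poly_Mapping.single k 1)" for S and f :: "'k \<Rightarrow> complex"
    using single[of _ 0] by (induction S rule: infinite_finite_induct) (auto intro: add)
  then show ?thesis by (subst single_decomp)
qed

lemma has_dim_0_iff: "has_dim S 0 \<longleftrightarrow> S = {0}"
  unfolding has_dim_def by (auto simp: cvec.span_empty intro!: exI[of _ "{}"] cvec.independent_empty)

lemma has_dim_1_multiple:
  assumes "has_dim S 1" "v \<in> S" "w \<in> S" "w \<noteq> 0"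
  shows "\<exists>c. v = c *\<^sub>C w"
proof -
  obtain b where b: "cvec.span {b} = S"
    using assms(1) unfolding has_dim_def by (auto simp: card_Suc_eq)
  obtain k l where k: "v = k *\<^sub>C b" and l: "w = l *\<^sub>C b"
    using assms(2,3) unfolding b[symmetric] cvec.span_singleton by auto
  have "l \<noteq> 0" using l assms(4) by auto
  then have "v = (k / l) *\<^sub>C w" unfolding k l scaleC_scaleC by simp
  then show ?thesis ..
qed

lemma clinear_comp: "clinear f \<Longrightarrow> clinear g \<Longrightarrow> clinear (g \<circ> f)"
  by (simp add: clinear_iff)

lemma clinear_inv:
  assumes "clinear g" "bij g"
  shows "clinear (inv g)"
proof -
  have add: "g (x + y) = g x + g y" and scale: "g (c *\<^sub>C x) = c *\<^sub>C g x" for x y c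
    using assms(1) by (auto simp: clinear_iff)
  have inv: "inv g y = x \<longleftrightarrow> y = g x" for x y
    using bij_inv_eq_iff[OF assms(2)] by metis
  have "g (inv g y) = y" for y using inv by metis
  then show ?thesis by (simp add: clinear_iff inv add scale)
qed

text \<open>Linearity and multiplicativity pass to the inverse of a bijective homomorphism; that the
  inverse preserves degrees is assumed. The map goes from the model \<open>B\<close> to
  \<open>A\<close>, since maps out of the models are given by explicit formulas.\<close>

lemma algebra_iso_bij:
  assumes g: "g \<in> algebra_hom B A" and bij: "bij g"
    and gr: "\<And>\<alpha> v. v \<in> grade A \<alpha> \<Longrightarrow> inv g v \<in> grade B \<alpha>"
  shows "A \<cong> B"
proof -
  have lin: "clinear g" and mult: "g (mult B t) = mult A (tensor_map g g t)"
    and unit: "g (unit_map B z) = unit_map A z" for t z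
    using g by (auto simp: algebra_hom_def hom_def fun_eq_iff)
  have lin': "clinear (inv g)" by (rule clinear_inv[OF lin bij])
  have gi: "g (inv g a) = a" and ig: "inv g (g b) = b" for a b
    using bij by (auto simp: bij_is_surj surj_f_inv_f bij_is_inj)
  \<comment> \<open>By functoriality of the tensor product every tensor over \<open>A\<close> is the
    image of one over \<open>B\<close>, where multiplicativity of \<open>g\<close> can be
    applied.\<close>
  have "tensor_map g g \<circ> tensor_map (inv g) (inv g) = id"
    using tensor_map[OF lin lin] tensor_map[OF lin' lin']
    by (intro tensor_ext) (auto simp: clinear_iff gi)
  then have "tensor_map g g (tensor_map (inv g) (inv g) t) = t" for t
    by (metis comp_apply id_apply)
  then have "inv g (mult A t) = mult B (tensor_map (inv g) (inv g) t)" for t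
    using mult[of "tensor_map (inv g) (inv g) t"] ig by metis
  moreover have "inv g (unit_map A z) = unit_map B z" for z
    using unit ig by metis
  ultimately have "inv g \<in> algebra_hom A B"
    using lin' gr by (auto simp: algebra_hom_def hom_def)
  then show ?thesis
    unfolding algebra_iso_def using g gi ig by (intro bexI[of _ "inv g"] bexI[of _ g]) auto
qed

section \<open>Invertibility of homogeneous elements\<close>

text \<open>The hypotheses of the classification with a pairing fixed. The assumption
  \<open>nonzero\<close> excludes the zero algebra, which satisfies the other ones but is isomorphic
  to neither model.\<close>

locale pairing_algebra =
  fixes A :: "'a::complex_vector graded_algebra" and r :: complex
    and \<omega> :: "('a, 'a) tensor \<Rightarrow> complex"
  assumes alg: "algebra A"
    and nonzero: "\<exists>a::'a. a \<noteq> 0"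
    and comm: "commutative r A"
    and pairing: "invariant_pairing A \<omega>"
    and nondeg: "nondegenerate \<omega>"
    and dims: "has_dim (grade A \<alpha>) 0 \<or> has_dim (grade A \<alpha>) 1"
begin

abbreviation prod :: "'a \<Rightarrow> 'a \<Rightarrow> 'a" (infixl \<open>\<odot>\<close> 75) where
  "a \<odot> b \<equiv> mult A (a \<otimes> b)"

definition e :: 'a where "e = unit_map A 1"

lemma graded: "graded_space (grade A)"
  using alg by (simp add: algebra_def)

lemma grade_subspace: "cvec.subspace (grade A \<alpha>)"
  using graded by (simp add: graded_space_def)

lemma clinear_mult: "clinear (mult A)" and clinear_unit: "clinear (unit_map A)"
  and clinear_pairing: "clinear \<omega>"
  using alg pairing by (auto simp: algebra_def invariant_pairing_def hom_def)

lemma prod_simps: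
  "(a + a') \<odot> b = a \<odot> b + a' \<odot> b" "a \<odot> (b + b') = a \<odot> b + a \<odot> b'"
  "(c *\<^sub>C a) \<odot> b = c *\<^sub>C (a \<odot> b)" "a \<odot> (c *\<^sub>C b) = c *\<^sub>C (a \<odot> b)"
  "0 \<odot> b = 0" "a \<odot> 0 = 0"
proof -
  show "(a + a') \<odot> b = a \<odot> b + a' \<odot> b" "a \<odot> (b + b') = a \<odot> b + a \<odot> b'"
    "(c *\<^sub>C a) \<odot> b = c *\<^sub>C (a \<odot> b)" and scale: "a \<odot> (c *\<^sub>C b) = c *\<^sub>C (a \<odot> b)"
    for a a' b b' c
    using clinear_mult by (auto simp: pure_tensor_bilinear clinear_iff)
  have "mult A 0 = 0" using scale[of 0 0 0] by (simp add: pure_tensor_zero)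
  then show "0 \<odot> b = 0" "a \<odot> 0 = 0" by (simp_all add: pure_tensor_zero)
qed

lemma unit_map_eq: "unit_map A z = z *\<^sub>C e"
proof -
  have "unit_map A (z *\<^sub>C 1) = z *\<^sub>C e"
    using clinear_unit unfolding clinear_iff e_def by blast
  then show ?thesis by (simp add: scaleC_complex_def)
qed

lemma prod_assoc: "(a \<odot> b) \<odot> c = a \<odot> (b \<odot> c)"
proof -
  have "(mult A \<circ> tensor_map (mult A) id) ((a \<otimes> b) \<otimes> c)
      = (mult A \<circ> tensor_map id (mult A) \<circ> associator) ((a \<otimes> b) \<otimes> c)"
    using alg by (simp only: algebra_def)
  then show ?thesis
    by (simp add: tensor_map(2) clinear_mult cvec.linear_id associator)
qed

lemma prod_unit: "e \<odot> a = a" "a \<odot> e = a"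
proof -
  have "(mult A \<circ> tensor_map (unit_map A) id) (1 \<otimes> a) = left_unitor (1 \<otimes> a)"
    "(mult A \<circ> tensor_map id (unit_map A)) (a \<otimes> 1) = right_unitor (a \<otimes> 1)"
    using alg by (simp_all only: algebra_def)
  then show "e \<odot> a = a" "a \<odot> e = a"
    by (simp_all add: tensor_map(2) clinear_unit cvec.linear_id left_unitor right_unitor
        unit_map_eq scaleC_one)
qed

lemma pairing_prod: "\<omega> (a \<otimes> (b \<odot> c)) = \<omega> ((a \<odot> b) \<otimes> c)"
proof -
  have "(\<omega> \<circ> tensor_map id (mult A) \<circ> associator) ((a \<otimes> b) \<otimes> c)
      = (\<omega> \<circ> tensor_map (mult A) id) ((a \<otimes> b) \<otimes> c)"
    using pairing by (simp only: invariant_pairing_def)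
  then show ?thesis
    by (simp add: tensor_map(2) clinear_mult cvec.linear_id associator)
qed

lemma tensor_grading_pure:
  "a \<in> grade A \<alpha> \<Longrightarrow> b \<in> grade A \<beta> \<Longrightarrow> a \<otimes> b \<in> tensor_grading (grade A) (grade A) (\<alpha> + \<beta>)"
  unfolding tensor_grading_def by (rule cvec.span_base) blast

lemma prod_grade: "a \<in> grade A \<alpha> \<Longrightarrow> b \<in> grade A \<beta> \<Longrightarrow> a \<odot> b \<in> grade A (\<alpha> + \<beta>)"
  using alg tensor_grading_pure[of a \<alpha> b \<beta>] by (auto simp: algebra_def hom_def)

lemma unit_grade: "e \<in> grade A 0"
  using alg by (auto simp: algebra_def hom_def unit_grading_def e_def)

text \<open>The tensor unit is concentrated in degree 0 and the pairing preserves degrees.\<close>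

lemma pairing_grade:
  assumes "a \<in> grade A \<alpha>" "b \<in> grade A \<beta>" "\<alpha> + \<beta> \<noteq> 0"
  shows "\<omega> (a \<otimes> b) = 0"
proof -
  have "\<omega> (a \<otimes> b) \<in> unit_grading (\<alpha> + \<beta>)"
    using pairing tensor_grading_pure[OF assms(1,2)] by (auto simp: invariant_pairing_def hom_def)
  then show ?thesis using assms(3) by (simp add: unit_grading_def)
qed

lemma prod_braided:
  assumes "a \<in> grade A \<alpha>" "b \<in> grade A \<beta>"
  shows "a \<odot> b = exp (of_real pi * \<i> * r / 2 * \<alpha> * \<beta>) *\<^sub>C (b \<odot> a)"
proof -
  have "a \<odot> b = mult A (braiding r (grade A) (grade A) (a \<otimes> b))"
    using comm unfolding commutative_def by (metis comp_apply)
  then show ?thesis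
    using clinear_mult by (simp add: braiding_homogeneous[OF graded graded assms] clinear_iff)
qed

lemma e_nonzero: "e \<noteq> 0"
  using nonzero prod_unit(1) prod_simps(5) by metis

lemma grade_multiple:
  assumes "v \<in> grade A \<alpha>" "w \<in> grade A \<alpha>" "w \<noteq> 0"
  obtains c where "v = c *\<^sub>C w"
proof -
  have "has_dim (grade A \<alpha>) 1" using dims[of \<alpha>] assms by (auto simp: has_dim_0_iff)
  then show ?thesis using has_dim_1_multiple assms that by blast
qed

text \<open>Non-degeneracy gives a partner of \<open>x\<close>, which the grading allows to be
  chosen of degree -\<alpha>. By invariance the product of the two is nonzero; it lies in degree 0,
  the line spanned by \<open>e\<close>, so rescaling the partner gives an inverse.\<close>

lemma homogeneous_invertible:
  assumes x: "x \<in> grade A \<alpha>" "x \<noteq> 0"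
  obtains y where "y \<in> grade A (- \<alpha>)" "x \<odot> y = e" "y \<odot> x = e"
proof -
  obtain b where b: "\<omega> (x \<otimes> b) \<noteq> 0" using nondeg x(2) unfolding nondegenerate_def by blast
  let ?b = "\<lambda>\<beta>. component (grade A) \<beta> b"
  have lin: "clinear (\<lambda>b. \<omega> (x \<otimes> b))"
    using clinear_pairing by (simp add: clinear_iff pure_tensor_bilinear)
  have dec: "b = (\<Sum>\<beta> | ?b \<beta> \<noteq> 0. ?b \<beta>)" and grb: "?b \<beta> \<in> grade A \<beta>" for \<beta>
    using is_decomp_component[OF graded, of b] unfolding is_decomp_def by auto
  \<comment> \<open>Some homogeneous component of \<open>b\<close> must already pair nontrivially
    with \<open>x\<close>, and only degree -\<alpha> can do so.\<close>
  have "\<omega> (x \<otimes> b) = (\<Sum>\<beta> | ?b \<beta> \<noteq> 0. \<omega> (x \<otimes> ?b \<beta>))"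
    by (subst dec) (rule module_hom.sum[OF lin[folded module_hom_iff_linear]])
  then obtain \<beta> where \<beta>: "\<omega> (x \<otimes> ?b \<beta>) \<noteq> 0" using b by (metis (mono_tags, lifting) sum.neutral)
  then have "\<alpha> + \<beta> = 0" using pairing_grade[OF x(1) grb] by blast
  then have "\<beta> = - \<alpha>" by (simp add: eq_neg_iff_add_eq_0 add.commute)
  define z where "z = ?b \<beta>"
  have z: "z \<in> grade A (- \<alpha>)" using grb[of \<beta>] by (simp add: z_def \<open>\<beta> = - \<alpha>\<close>)
  \<comment> \<open>Invariance with \<open>e\<close> as third factor turns the pairing of
    \<open>x\<close> and \<open>z\<close> into one of their product with \<open>e\<close>.\<close>
  have "\<omega> ((x \<odot> z) \<otimes> e) \<noteq> 0" using \<beta> pairing_prod[of x z e] by (simp add: prod_unit z_def)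
  moreover have "\<omega> 0 = 0" using module_hom.zero clinear_pairing module_hom_iff_linear by blast
  ultimately have "x \<odot> z \<noteq> 0" by (auto simp: pure_tensor_zero)
  obtain c where c: "x \<odot> z = c *\<^sub>C e"
    using grade_multiple[OF _ unit_grade e_nonzero] prod_grade[OF x(1) z] by auto
  have "c \<noteq> 0" using c \<open>x \<odot> z \<noteq> 0\<close> by auto
  define y where "y = inverse c *\<^sub>C z"
  have y: "y \<in> grade A (- \<alpha>)"
    using z grade_subspace unfolding y_def by (simp add: cvec.subspace_scale)
  have xy: "x \<odot> y = e"
    using \<open>c \<noteq> 0\<close> unfolding y_def by (simp add: prod_simps c scaleC_scaleC scaleC_one)
  \<comment> \<open>The right inverse is a left inverse: \<open>y \<odot> x\<close> is a multiple of
    \<open>e\<close> by its degree, and associativity in \<open>x \<odot> y \<odot> x\<close> makes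
    the factor 1.\<close>
  obtain d where d: "y \<odot> x = d *\<^sub>C e"
    using grade_multiple[OF _ unit_grade e_nonzero] prod_grade[OF y x(1)] by auto
  have "d *\<^sub>C x = x \<odot> (y \<odot> x)" by (simp add: d prod_simps prod_unit)
  also have "\<dots> = 1 *\<^sub>C x" by (simp add: prod_assoc[symmetric] xy prod_unit scaleC_one)
  finally have "d = 1" using x(2) by (simp add: cvec.scale_right_imp_eq)
  then have "y \<odot> x = e" by (simp add: d scaleC_one)
  then show ?thesis using that y xy by blast
qed

text \<open>A left inverse of \<open>x\<close> recovers \<open>y\<close> from the product;
  \<open>y\<close> may be inhomogeneous.\<close>

lemma prod_nonzero:
  assumes "x \<in> grade A \<alpha>" "x \<noteq> 0" "y \<noteq> 0"
  shows "x \<odot> y \<noteq> 0"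
proof -
  obtain z where "z \<odot> x = e" using homogeneous_invertible[OF assms(1,2)] by blast
  then have "z \<odot> (x \<odot> y) = y" by (simp add: prod_assoc[symmetric] prod_unit)
  then show ?thesis using assms(3) by (auto simp: prod_simps)
qed

section \<open>The group of degrees and its quadratic form\<close>

definition degrees :: "complex set" where
  "degrees = {\<alpha>. \<exists>x\<in>grade A \<alpha>. x \<noteq> 0}"

text \<open>The witness is an element of degree \<alpha> times the inverse of one of degree
  \<beta>.\<close>

lemma degrees_diff:
  assumes "\<alpha> \<in> degrees" "\<beta> \<in> degrees"
  shows "\<alpha> - \<beta> \<in> degrees"
proof -
  obtain x y where x: "x \<in> grade A \<alpha>" "x \<noteq> 0" and y: "y \<in> grade A \<beta>" "y \<noteq> 0"
    using assms by (auto simp: degrees_def)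
  obtain z where z: "z \<in> grade A (- \<beta>)" "y \<odot> z = e" using homogeneous_invertible[OF y] by blast
  have "z \<noteq> 0" using z(2) e_nonzero by (auto simp: prod_simps)
  then have "x \<odot> z \<noteq> 0" using prod_nonzero x by blast
  moreover have "x \<odot> z \<in> grade A (\<alpha> - \<beta>)" using prod_grade[OF x(1) z(1)] by simp
  ultimately show ?thesis by (auto simp: degrees_def)
qed

text \<open>The self-braiding of \<open>x\<close> is a scalar that fixes the nonzero square of
  \<open>x\<close>, hence equals 1. Its exponent is then an integer multiple of
  \<open>2 * pi * \<i>\<close>.\<close>

lemma degrees_integral:
  assumes "\<alpha> \<in> degrees"
  shows "r / 4 * \<alpha>\<^sup>2 \<in> \<int>"
proof -
  obtain x where x: "x \<in> grade A \<alpha>" "x \<noteq> 0" using assms by (auto simp: degrees_def)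
  let ?q = "of_real pi * \<i> * r / 2 * \<alpha> * \<alpha>"
  have "exp ?q *\<^sub>C (x \<odot> x) = 1 *\<^sub>C (x \<odot> x)"
    using prod_braided[OF x(1) x(1)] by (simp add: scaleC_one)
  then have "exp ?q = 1" using prod_nonzero[OF x x(2)] by (simp add: cvec.scale_right_imp_eq)
  then obtain n :: int where n: "Re ?q = 0" "Im ?q = of_int (2 * n) * pi"
    unfolding exp_eq_1 by blast
  \<comment> \<open>The kernel of \<open>exp\<close> was obtained through real and imaginary parts;
    it is reassembled here as a complex equation from which the factor \<open>2 * pi * \<i>\<close>
    cancels.\<close>
  have "?q = of_real pi * (2 * \<i>) * of_int n"
    using n by (intro complex_eqI) (simp_all only:, simp_all)
  moreover have "?q = of_real pi * (2 * \<i>) * (r / 4 * \<alpha>\<^sup>2)" by (simp add: power2_eq_square)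
  ultimately have "of_real pi * (2 * \<i>) * (r / 4 * \<alpha>\<^sup>2) = of_real pi * (2 * \<i>) * of_int n"
    by metis
  then have "r / 4 * \<alpha>\<^sup>2 = of_int n" by (subst (asm) mult_cancel_left) simp
  then show ?thesis by simp
qed

section \<open>Isomorphisms with the two models\<close>

text \<open>Here \<open>A\<close> is its own degree 0 component, the line spanned by
  \<open>e\<close>, and the unit map is the isomorphism.\<close>

lemma algebra_iso_unit_algebra:
  assumes "degrees \<subseteq> {0}"
  shows "A \<cong> unit_algebra"
proof (rule algebra_iso_bij[of "unit_map A"])
  have mult_eq: "left_unitor (z \<otimes> w) = z * w" for z w :: complex
    by (simp add: left_unitor scaleC_complex_def)
  have "unit_map A \<circ> left_unitor = mult A \<circ> tensor_map (unit_map A) (unit_map A)"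
  proof (rule tensor_ext)
    show "clinear (unit_map A \<circ> left_unitor)"
      by (rule clinear_comp[OF left_unitor(1) clinear_unit])
    show "clinear (mult A \<circ> tensor_map (unit_map A) (unit_map A))"
      by (rule clinear_comp[OF tensor_map(1)[OF clinear_unit clinear_unit] clinear_mult])
  qed (simp add: tensor_map(2)[OF clinear_unit clinear_unit] mult_eq unit_map_eq prod_simps
      prod_unit scaleC_scaleC)
  moreover have "unit_map A \<in> hom unit_grading (grade A)" using alg by (simp add: algebra_def)
  ultimately show "unit_map A \<in> algebra_hom unit_algebra A"
    by (simp add: algebra_hom_def unit_algebra_def)
  have grade0: "v = 0" if "v \<in> grade A \<alpha>" "\<alpha> \<noteq> 0" for v \<alpha>
    using assms that by (auto simp: degrees_def)
  have inj: "inj (unit_map A)"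
    using e_nonzero by (auto simp: inj_def unit_map_eq intro: cvec.scale_right_imp_eq)
  have "v \<in> range (unit_map A)" for v
  proof -
    let ?v = "\<lambda>\<beta>. component (grade A) \<beta> v"
    have dec: "v = (\<Sum>\<beta> | ?v \<beta> \<noteq> 0. ?v \<beta>)" and gr: "?v \<beta> \<in> grade A \<beta>" for \<beta>
      using is_decomp_component[OF graded, of v] unfolding is_decomp_def by auto
    have "{\<beta>. ?v \<beta> \<noteq> 0} \<subseteq> {0}" using grade0[OF gr] by blast
    then have "(\<Sum>\<beta> | ?v \<beta> \<noteq> 0. ?v \<beta>) = (\<Sum>\<beta>\<in>{0}. ?v \<beta>)"
      by (intro sum.mono_neutral_left) auto
    then have "v \<in> grade A 0" using dec gr[of 0] by simp
    then obtain c where "v = c *\<^sub>C e" using grade_multiple unit_grade e_nonzero by blast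
    then show ?thesis by (metis unit_map_eq rangeI)
  qed
  then show "bij (unit_map A)" using inj by (auto simp: bij_def)
  show "inv (unit_map A) v \<in> grade unit_algebra \<alpha>" if "v \<in> grade A \<alpha>" for \<alpha> v
  proof (cases "\<alpha> = 0")
    case False
    then have "v = unit_map A 0" using grade0[OF that] by (simp add: unit_map_eq)
    then have "inv (unit_map A) v = 0" using inj by simp
    then show ?thesis by (simp add: unit_algebra_def unit_grading_def)
  qed (simp add: unit_algebra_def unit_grading_def)
qed

text \<open>These are the integer powers of an invertible element of degree \<gamma>. None vanishes,
  because opposite powers multiply to \<open>e\<close>.\<close>

lemma homogeneous_powers:
  assumes "\<gamma> \<in> degrees"
  obtains u :: "int \<Rightarrow> 'a" where "u 0 = e" "\<And>m n. u m \<odot> u n = u (m + n)"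
    "\<And>m. u m \<in> grade A (of_int m * \<gamma>)" "\<And>m. u m \<noteq> 0"
proof -
  obtain x where x: "x \<in> grade A \<gamma>" "x \<noteq> 0" using assms by (auto simp: degrees_def)
  obtain y where y: "y \<in> grade A (- \<gamma>)" "x \<odot> y = e" "y \<odot> x = e"
    using homogeneous_invertible[OF x] by blast
  define u where
    "u m = (if m \<ge> 0 then ((\<odot>) x ^^ nat m) e else ((\<odot>) y ^^ nat (- m)) e)" for m
  have u0: "u 0 = e" by (simp add: u_def)
  have yx: "y \<odot> (x \<odot> v) = v" and xy: "x \<odot> (y \<odot> v) = v" for v
    by (simp_all add: prod_assoc[symmetric] y prod_unit)
  have up: "u (m + 1) = x \<odot> u m" for m
  proof (cases "m \<ge> 0")
    case True
    then show ?thesis by (simp add: u_def nat_add_distrib)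
  next
    case False
    \<comment> \<open>With \<open>m = - k - 1\<close>, the factor \<open>x\<close> cancels the
      outermost \<open>y\<close>. The case \<open>k = 0\<close> is separate, since
      \<open>m + 1\<close> is then 0 and falls under the other branch of the definition of
      \<open>u\<close>.\<close>
    define k where "k = nat (- m - 1)"
    have "m = - int k - 1" using False by (simp add: k_def)
    then have "nat (- m) = Suc k" "nat (- (m + 1)) = k" by auto
    then show ?thesis
      using False \<open>m = - int k - 1\<close> by (cases "k = 0") (auto simp: u_def xy y(2) prod_unit)
  qed
  have down: "u (m - 1) = y \<odot> u m" for m
    using up[of "m - 1"] by (simp add: yx)
  have mult: "u m \<odot> u n = u (m + n)" for m n
  proof (induction m rule: int_induct[of _ 0])
    case base
    then show ?case by (simp add: u0 prod_unit)
  next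
    case (step1 i)
    have "u (i + 1 + n) = u (i + n + 1)" by (simp add: algebra_simps)
    then show ?case using step1 by (simp add: up prod_assoc)
  next
    case (step2 i)
    have "u (i - 1 + n) = u (i + n - 1)" by (simp add: algebra_simps)
    then show ?case using step2 by (simp add: down prod_assoc)
  qed
  have gr: "u m \<in> grade A (of_int m * \<gamma>)" for m
  proof (induction m rule: int_induct[of _ 0])
    case base
    then show ?case by (simp add: u0 unit_grade)
  next
    case (step1 i)
    then show ?case using prod_grade[OF x(1) step1(2)] up[of i] by (simp add: algebra_simps)
  next
    case (step2 i)
    then show ?case using prod_grade[OF y(1) step2(2)] by (simp add: down algebra_simps)
  qed
  have "u m \<noteq> 0" for m
    using mult[of m "- m"] e_nonzero u0 by (auto simp: prod_simps)
  then show ?thesis using that u0 mult gr by blast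
qed

text \<open>The isomorphism sends the basis vector of degree m\<gamma> to the m-th power of an
  invertible element of degree \<gamma>. These powers span all nonzero components, as every degree
  is a multiple of \<gamma> and components are at most one-dimensional.\<close>

lemma algebra_iso_lattice_algebra:
  assumes \<gamma>: "\<gamma> \<in> degrees" "\<gamma> \<noteq> 0"
    and cyclic: "\<And>\<beta>. \<beta> \<in> degrees \<Longrightarrow> \<exists>m. \<beta> = of_int m * \<gamma>"
  shows "A \<cong> lattice_algebra \<gamma>"
proof -
  obtain u :: "int \<Rightarrow> 'a" where u0: "u 0 = e" and umult: "\<And>m n. u m \<odot> u n = u (m + n)"
    and ugr: "\<And>m. u m \<in> grade A (of_int m * \<gamma>)" and unz: "\<And>m. u m \<noteq> 0"
    using homogeneous_powers[OF \<gamma>(1)] by blast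
  define F where "F x = (\<Sum>m\<in>Poly_Mapping.keys x. Poly_Mapping.lookup x m *\<^sub>C u m)"
    for x :: "int \<Rightarrow>\<^sub>0 complex"
  \<comment> \<open>Enlarging the index set allows \<open>x\<close>, \<open>y\<close> and
    \<open>x + y\<close> to be summed over a common one.\<close>
  have F_on: "F x = (\<Sum>m\<in>S. Poly_Mapping.lookup x m *\<^sub>C u m)"
    if "finite S" "Poly_Mapping.keys x \<subseteq> S" for x S
    unfolding F_def using that by (intro sum.mono_neutral_left) (auto simp: in_keys_iff)
  have F_add: "F (x + y) = F x + F y" for x y
    unfolding F_on[of "Poly_Mapping.keys x \<union> Poly_Mapping.keys y" x, OF _ Un_upper1, simplified]
      F_on[of "Poly_Mapping.keys x \<union> Poly_Mapping.keys y" y, OF _ Un_upper2, simplified]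
      F_on[of "Poly_Mapping.keys x \<union> Poly_Mapping.keys y" "x + y", OF _ Poly_Mapping.keys_add, simplified]
    by (simp add: lookup_add scaleC_add_left sum.distrib)
  have F_scale: "F (c *\<^sub>C x) = c *\<^sub>C F x" for c x
  proof -
    have "Poly_Mapping.keys (c *\<^sub>C x) \<subseteq> Poly_Mapping.keys x"
      by (auto simp: in_keys_iff lookup_scaleC scaleC_complex_def)
    then show ?thesis
      using F_on[of "Poly_Mapping.keys x" "c *\<^sub>C x"]
      by (simp add: F_def lookup_scaleC scaleC_complex_def cvec.scale_sum_right scaleC_scaleC)
  qed
  have F_lin: "clinear F" by (simp add: clinear_iff F_add F_scale)
  note F_hom = F_lin[folded module_hom_iff_linear]
  have F_single: "F (Poly_Mapping.single m c) = c *\<^sub>C u m" for m c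
    using F_on[of "{m}" "Poly_Mapping.single m c"] by simp
  have F_mult: "F (x * y) = F x \<odot> F y" for x y
  proof (induction x rule: poly_mapping_single_add_induct)
    case (single m c)
    show ?case
      by (induction y rule: poly_mapping_single_add_induct)
        (simp_all add: mult_single F_single prod_simps umult scaleC_scaleC F_add algebra_simps)
  qed (simp add: distrib_right F_add prod_simps)
  \<comment> \<open>As \<gamma> is nonzero, distinct integers give distinct degrees, so graded
    components recover the coefficients. Injectivity of \<open>F\<close> rests on this.\<close>
  have F_comp: "component (grade A) (of_int k * \<gamma>) (F x) = Poly_Mapping.lookup x k *\<^sub>C u k" for x k
  proof (induction x rule: poly_mapping_single_add_induct)
    case (single m c)
    have "c *\<^sub>C u m \<in> grade A (of_int m * \<gamma>)"
      using ugr grade_subspace by (simp add: cvec.subspace_scale)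
    then show ?case
      using \<gamma>(2) by (simp add: F_single component_homogeneous[OF graded] lookup_single when_def)
  next
    case (add x y)
    then show ?case
      using clinear_component[OF graded] by (simp add: clinear_iff F_add lookup_add scaleC_add_left)
  qed
  have inj: "inj F"
  proof (rule injI, rule poly_mapping_eqI)
    fix x y k assume "F x = F y"
    then have "Poly_Mapping.lookup x k *\<^sub>C u k = Poly_Mapping.lookup y k *\<^sub>C u k"
      by (metis F_comp)
    then show "Poly_Mapping.lookup x k = Poly_Mapping.lookup y k"
      using unz by (simp add: cvec.scale_right_imp_eq)
  qed
  \<comment> \<open>Used both for surjectivity, component by component, and to show that the inverse
    preserves degrees. The alternative \<open>v = 0\<close> covers degrees that are not multiples of
    \<gamma>.\<close>
  have homog: "v = 0 \<or> (\<exists>m c. \<alpha> = of_int m * \<gamma> \<and> v = F (Poly_Mapping.single m c))"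
    if v: "v \<in> grade A \<alpha>" for v \<alpha>
  proof (cases "v = 0")
    case False
    then obtain m where m: "\<alpha> = of_int m * \<gamma>"
      using cyclic[of \<alpha>] v False by (auto simp: degrees_def)
    obtain c where "v = c *\<^sub>C u m" using grade_multiple[OF v] ugr[of m] unz[of m] m by blast
    then show ?thesis using m F_single by metis
  qed simp
  have F0: "F 0 = 0" by (rule module_hom.zero[OF F_hom])
  have "v \<in> range F" for v
  proof -
    let ?v = "\<lambda>\<beta>. component (grade A) \<beta> v"
    have dec: "v = (\<Sum>\<beta> | ?v \<beta> \<noteq> 0. ?v \<beta>)" and gr: "?v \<beta> \<in> grade A \<beta>" for \<beta>
      using is_decomp_component[OF graded, of v] unfolding is_decomp_def by auto
    have "?v \<beta> \<in> range F" for \<beta> using homog[OF gr[of \<beta>]] F0 by (metis rangeI)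
    then have "?v \<beta> = F (inv F (?v \<beta>))" for \<beta> by (simp add: f_inv_into_f)
    then have "v = (\<Sum>\<beta> | ?v \<beta> \<noteq> 0. F (inv F (?v \<beta>)))" using dec by simp
    also have "\<dots> = F (\<Sum>\<beta> | ?v \<beta> \<noteq> 0. inv F (?v \<beta>))"
      by (rule module_hom.sum[OF F_hom, symmetric])
    finally show ?thesis by (rule range_eqI)
  qed
  then have bij: "bij F" using inj by (auto simp: bij_def)
  have "F \<circ> tensor_lift (*) = mult A \<circ> tensor_map F F"
    using tensor_map[OF F_lin F_lin] clinear_mult F_lin tensor_lift[OF bilinear_lattice_mult]
    by (intro tensor_ext) (auto simp: clinear_iff F_mult)
  moreover have "F \<circ> Poly_Mapping.single 0 = unit_map A"
    by (auto simp: fun_eq_iff F_single u0 unit_map_eq)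
  moreover have "F x \<in> grade A \<alpha>"
    if "\<forall>m. Poly_Mapping.lookup x m \<noteq> 0 \<longrightarrow> of_int m * \<gamma> = \<alpha>" for x \<alpha>
    unfolding F_def
    by (intro cvec.subspace_sum cvec.subspace_scale grade_subspace)
      (use that ugr in \<open>auto simp: in_keys_iff\<close>)
  ultimately have "F \<in> algebra_hom (lattice_algebra \<gamma>) A"
    using F_lin by (auto simp: algebra_hom_def hom_def lattice_algebra_def)
  then show ?thesis
  proof (rule algebra_iso_bij[OF _ bij])
    fix \<alpha> v assume "v \<in> grade A \<alpha>"
    from homog[OF this] show "inv F v \<in> grade (lattice_algebra \<gamma>) \<alpha>"
    proof (elim disjE exE conjE)
      assume "v = 0"
      then have "inv F v = 0" using inv_f_f[OF inj, of 0] F0 by simp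
      then show ?thesis by (simp add: lattice_algebra_def)
    qed (auto simp: lattice_algebra_def inj lookup_single when_def)
  qed
qed

end

section \<open>The choice of \<open>p\<close> and the two square roots\<close>

theorem proposition2p15:
  fixes r :: complex and A :: "'a::complex_vector graded_algebra"
  assumes "r \<noteq> 0"
    and "algebra A"
    and "\<exists>a::'a. a \<noteq> 0"
    and "commutative r A"
    and "\<exists>\<omega>. invariant_pairing A \<omega> \<and> nondegenerate \<omega>"
    and "\<forall>\<alpha>. has_dim (grade A \<alpha>) 0 \<or> has_dim (grade A \<alpha>) 1"
  shows "A \<cong> unit_algebra \<or>
    (\<exists>p::int. p \<noteq> 0 \<and>
      (\<forall>s::complex. s\<^sup>2 = of_int p / r \<longrightarrow> A \<cong> lattice_algebra (2 * s)))"
proof -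
  obtain \<omega> where "invariant_pairing A \<omega>" "nondegenerate \<omega>" using assms(5) by blast
  then interpret pairing_algebra A r \<omega>
    using assms by unfold_locales auto
  show ?thesis
  proof (cases "degrees \<subseteq> {0}")
    case True
    then show ?thesis using algebra_iso_unit_algebra by blast
  next
    case False
    have "r / 4 \<noteq> 0" using assms(1) by simp
    then obtain \<gamma> where \<gamma>: "\<gamma> \<noteq> 0" "\<gamma> \<in> degrees"
      and cyclic: "\<And>\<beta>. \<beta> \<in> degrees \<Longrightarrow> \<exists>m. \<beta> = of_int m * \<gamma>"
      using additive_group_integral_form_cyclic[of "r / 4" degrees]
        degrees_diff degrees_integral False by blast
    \<comment> \<open>The integer \<open>p\<close> is the value of the form at the generator, so
      that \<gamma> is twice a square root of \<open>p / r\<close>.\<close>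
    obtain p where p: "r / 4 * \<gamma>\<^sup>2 = of_int p" using degrees_integral[OF \<gamma>(2)] by (elim Ints_cases)
    have "p \<noteq> 0" using p assms(1) \<gamma>(1) by auto
    \<comment> \<open>The statement covers both roots: \<open>2 * s\<close> is \<gamma> or its
      negative, and each of them generates the group of degrees.\<close>
    moreover have "A \<cong> lattice_algebra (2 * s)" if "s\<^sup>2 = of_int p / r" for s
    proof -
      have "(2 * s)\<^sup>2 = \<gamma>\<^sup>2"
        using that assms(1) by (simp add: power_mult_distrib p[symmetric] mult.commute)
      then consider "2 * s = \<gamma>" | "2 * s = - \<gamma>" using power2_eq_iff[of "2 * s" \<gamma>] by metis
      then show ?thesis
      proof cases
        case 1
        then show ?thesis using algebra_iso_lattice_algebra \<gamma> cyclic by simp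
      next
        case 2
        have "- \<gamma> \<in> degrees"
          using degrees_diff[OF degrees_diff[OF \<gamma>(2) \<gamma>(2)] \<gamma>(2)] by simp
        moreover have "\<exists>m. \<beta> = of_int m * - \<gamma>" if "\<beta> \<in> degrees" for \<beta>
        proof -
          obtain m where "\<beta> = of_int m * \<gamma>" using cyclic[OF \<open>\<beta> \<in> degrees\<close>] by blast
          then have "\<beta> = of_int (- m) * - \<gamma>" by simp
          then show ?thesis by blast
        qed
        ultimately show ?thesis
          unfolding 2 by (intro algebra_iso_lattice_algebra) (use \<gamma> in auto)
      qed
    qed
    ultimately show ?thesis by blast
  qed
qed

end
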